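(* Let $m$ be an integer that is not a cube, let $K = \mathbb{Q}(\omega)$ with $\omega^3 = m$ be the corresponding pure cubic field, and let $b \in \mathbb{Q}^\times$ be fixed. Let $E_m'$ be the elliptic curve $y^2 = x^3 - mb^3$, a quadratic twist of the elliptic curve $E_m : y^2 = x^3 - m$. There is a bijection between the elements $\alpha \in K^\times$ with $\alpha^2 = a - b\omega$ for some $a \in \mathbb{Q}$ and the affine rational points $(x,y) \in E_m'(\mathbb{Q})$. In fact, if $\alpha = r + s\omega + t\omega^2$ with $r,s,t\in\mathbb{Q}$ satisfies $\alpha^2 = a - b\omega$, then the corresponding point is $(x,y) \in E_m'(\mathbb{Q})$ with $x = bs/t$ and $y = b^2/t$. Conversely, an affine point $(x,y) \in E_m'(\mathbb{Q})$ corresponds to $$\alpha = -\frac{x^2}{2y} + \frac{bx}{y}\,\omega + \frac{b^2}{y}\,\omega^2 \qquad \text{with } \alpha^2 = \frac{x^4 + 8mb^3x}{4y^2} - b\omega .$$ In particular, for $a, y \in \mathbb{Q}$, the element $a - b\omega$ is a square in $K$ with $N(a - b\omega) = y^2$ if and only if $(a,y) \in 2E_m'(\mathbb{Q})$.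
   Context: $N = N_{K/\mathbb{Q}}$ is the norm, and $2E_m'(\mathbb{Q}) = \{2Q : Q \in E_m'(\mathbb{Q})\}$. *)

theory Defs
  imports Complex_Main "Jordan_Normal_Form.Determinant"
begin

definition is_subfield :: "'a::field set \<Rightarrow> bool" where
  "is_subfield F \<longleftrightarrow> 0 \<in> F \<and> 1 \<in> F \<and>
     (\<forall>x\<in>F. \<forall>y\<in>F. x - y \<in> F \<and> x * y \<in> F) \<and> (\<forall>x\<in>F. inverse x \<in> F)"

(* In characteristic 0 every subfield contains the prime field of rationals,
   so this is the extension of the rationals generated by w. *)
definition rat_adjoin :: "'a::field_char_0 \<Rightarrow> 'a set" where
  "rat_adjoin w = \<Inter>{F. is_subfield F \<and> w \<in> F}"

definition rat_scale :: "rat \<Rightarrow> 'a::field_char_0 \<Rightarrow> 'a" where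
  "rat_scale q x = of_rat q * x"

global_interpretation rat_vs: vector_space "rat_scale :: rat \<Rightarrow> 'a::field_char_0 \<Rightarrow> 'a"
  by unfold_locales
     (simp_all add: rat_scale_def of_rat_add of_rat_mult algebra_simps)

definition is_rat_basis :: "'a::field_char_0 set \<Rightarrow> 'a list \<Rightarrow> bool" where
  "is_rat_basis K bs \<longleftrightarrow>
     distinct bs \<and> rat_vs.independent (set bs) \<and> rat_vs.span (set bs) = K"

definition mult_matrix :: "'a::field_char_0 list \<Rightarrow> 'a \<Rightarrow> rat mat" where
  "mult_matrix bs \<alpha> = mat (length bs) (length bs)
     (\<lambda>(i, j). rat_vs.representation (set bs) (\<alpha> * bs ! j) (bs ! i))"

(* The determinant of multiplication by \<alpha> does not depend on the chosen basis.
   The value is meaningful only for K finite over the rationals and \<alpha> in K. *)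
definition field_norm :: "'a::field_char_0 set \<Rightarrow> 'a \<Rightarrow> rat" where
  "field_norm K \<alpha> = det (mult_matrix (SOME bs. is_rat_basis K bs) \<alpha>)"

(* Throughout, A and B are the coefficients of y^2 = x^3 + A x + B. *)
datatype 'k ec_point = Infinity | Affine 'k 'k

definition elliptic_curve :: "'k::field_char_0 \<Rightarrow> 'k \<Rightarrow> bool" where
  "elliptic_curve A B \<longleftrightarrow> 4 * A ^ 3 + 27 * B ^ 2 \<noteq> 0"

definition ec_affine_points :: "'k::field_char_0 \<Rightarrow> 'k \<Rightarrow> 'k ec_point set" where
  "ec_affine_points A B = {Affine x y | x y. y ^ 2 = x ^ 3 + A * x + B}"

definition ec_points :: "'k::field_char_0 \<Rightarrow> 'k \<Rightarrow> 'k ec_point set" where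
  "ec_points A B = insert Infinity (ec_affine_points A B)"

(* The chord-tangent law; it does not involve the coefficient B. *)
fun ec_add :: "'k::field_char_0 \<Rightarrow> 'k ec_point \<Rightarrow> 'k ec_point \<Rightarrow> 'k ec_point" where
  "ec_add A Infinity Q = Q"
| "ec_add A P Infinity = P"
| "ec_add A (Affine x1 y1) (Affine x2 y2) =
     (if x1 = x2 \<and> y1 = - y2 then Infinity
      else let l = (if x1 = x2 then (3 * x1 ^ 2 + A) / (2 * y1) else (y2 - y1) / (x2 - x1));
               x3 = l ^ 2 - x1 - x2
           in Affine x3 (l * (x1 - x3) - y1))"

definition ec_doubles :: "'k::field_char_0 \<Rightarrow> 'k \<Rightarrow> 'k ec_point set" where
  "ec_doubles A B = {ec_add A Q Q | Q. Q \<in> ec_points A B}"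

(* d y^2 = x^3 + A x + B becomes y^2 = x^3 + d^2 A x + d^3 B after rescaling;
   d may be a square, in which case the twist is trivial. *)
definition quadratic_twist :: "'k::field_char_0 \<Rightarrow> 'k \<Rightarrow> 'k \<Rightarrow> 'k \<Rightarrow> bool" where
  "quadratic_twist A B A' B' \<longleftrightarrow> (\<exists>d. d \<noteq> 0 \<and> A' = d ^ 2 * A \<and> B' = d ^ 3 * B)"

end

theory Submission
  imports Defs
begin

text \<open>
  Comparing coefficients in \<open>(r + s \<omega> + t \<omega>\<^sup>2)\<^sup>2 = a - b \<omega>\<close> gives \<open>s\<^sup>2 + 2 r t = 0\<close> and
  \<open>2 r s + m t\<^sup>2 = - b\<close>. Eliminating \<open>r\<close> leaves the plane cubic \<open>s\<^sup>3 - m t\<^sup>3 = b t\<close>, on which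
  \<open>t \<noteq> 0\<close>, and \<open>x = b s / t\<close>, \<open>y = b\<^sup>2 / t\<close> puts it into Weierstrass form. The remaining coefficient
  \<open>a = r\<^sup>2 + 2 m s t\<close> is the \<open>x\<close>-coordinate of the doubled point. Since \<open>N(a - b \<omega>) = a\<^sup>3 - m b\<^sup>3\<close>,
  the norm condition says that \<open>(a, y)\<close> lies on the curve, hence equals the double of the point or of its
  negative.
\<close>

section \<open>Rational cube roots of integers\<close>

text \<open>In lowest terms \<open>n ^ 3 = m * d ^ 3\<close>, so \<open>d ^ 3\<close> divides
  \<open>n ^ 3\<close> while being coprime to it; hence \<open>d = 1\<close>. This carries the
  assumption that \<open>m\<close> is not a cube from integers to rationals.\<close>

lemma rat_cube_eq_int:
  fixes q :: rat and m :: int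
  assumes "q ^ 3 = of_int m"
  shows "\<exists>k::int. m = k ^ 3"
proof -
  obtain n d where nd: "quotient_of q = (n, d)"
    by (cases "quotient_of q")
  have d: "d > 0" and cop: "coprime n d" and q: "q = of_int n / of_int d"
    using quotient_of_denom_pos[OF nd] quotient_of_coprime[OF nd] quotient_of_div[OF nd] by auto
  have "(of_int n :: rat) ^ 3 = of_int m * of_int d ^ 3"
    using assms d unfolding q by (simp add: power_divide field_simps)
  then have eq: "n ^ 3 = m * d ^ 3"
    by (metis of_int_eq_iff of_int_mult of_int_power)
  then have "d ^ 3 dvd n ^ 3"
    by simp
  then have "is_unit (d ^ 3)"
    using cop by (metis coprime_common_divisor coprime_power_left_iff coprime_power_right_iff dvd_refl)
  then have "d = 1"
    using d by (simp only: is_unit_power_iff) simp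
  then show ?thesis
    using eq by auto
qed

section \<open>Independence of the norm from the basis\<close>

lemma rat_basis_expansion:
  assumes "is_rat_basis K bs" "x \<in> K"
  shows "x = (\<Sum>k = 0..<length bs. rat_scale (rat_vs.representation (set bs) x (bs ! k)) (bs ! k))"
proof -
  have b: "distinct bs" "rat_vs.independent (set bs)" "x \<in> rat_vs.span (set bs)"
    using assms by (auto simp: is_rat_basis_def)
  have "x = (\<Sum>v\<in>set bs. rat_scale (rat_vs.representation (set bs) x v) v)"
    by (rule rat_vs.sum_representation_eq[symmetric]) (use b in auto)
  also have "\<dots> = (\<Sum>k = 0..<length bs. rat_scale (rat_vs.representation (set bs) x (bs ! k)) (bs ! k))"
    by (rule sum.reindex_bij_betw[symmetric])
      (use bij_betw_nth[OF b(1)] in \<open>auto simp: atLeast0LessThan\<close>)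
  finally show ?thesis .
qed

text \<open>\<open>rat_vs.representation\<close> takes the default value 0 outside the span, so
  linearity is claimed only for vectors in \<open>K\<close>.\<close>

lemma rat_basis_representation_sum:
  assumes "is_rat_basis K bs" and "\<And>k. k \<in> I \<Longrightarrow> v k \<in> K"
  shows "rat_vs.representation (set bs) (\<Sum>k\<in>I. rat_scale (c k) (v k)) x
    = (\<Sum>k\<in>I. c k * rat_vs.representation (set bs) (v k) x)"
proof -
  have b: "rat_vs.independent (set bs)" "\<And>k. k \<in> I \<Longrightarrow> v k \<in> rat_vs.span (set bs)"
    using assms by (auto simp: is_rat_basis_def)
  then show ?thesis
    by (simp add: rat_vs.representation_sum rat_vs.representation_scale rat_vs.span_scale)
qed

text \<open>The transition matrix from \<open>cs\<close>-coordinates to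
  \<open>bs\<close>-coordinates.\<close>

definition basis_change :: "'a::field_char_0 list \<Rightarrow> 'a list \<Rightarrow> rat mat" where
  "basis_change bs cs = mat (length bs) (length cs)
     (\<lambda>(i, j). rat_vs.representation (set bs) (cs ! j) (bs ! i))"

lemma rat_basis_nth_mem:
  assumes "is_rat_basis K bs" "k < length bs"
  shows "bs ! k \<in> K"
  using assms by (auto simp: is_rat_basis_def intro: rat_vs.span_base)

text \<open>Invariance of dimension; it makes the transition matrices square.\<close>

lemma rat_basis_length_eq:
  assumes "is_rat_basis K bs" "is_rat_basis K cs"
  shows "length bs = length cs"
proof -
  have "\<exists>f. bij_betw f (set bs) (set cs)"
    using rat_vs.bij_if_span_eq_span_bases[of "set bs" "set cs"] assms
    by (auto simp: is_rat_basis_def)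
  then have "card (set bs) = card (set cs)"
    using bij_betw_same_card by blast
  then show ?thesis
    using assms by (simp add: is_rat_basis_def distinct_card)
qed

text \<open>Expanding \<open>bs ! j\<close> in \<open>cs\<close>, and then each
  \<open>cs ! k\<close> in \<open>bs\<close>, must give back the \<open>bs\<close>-coordinates of
  \<open>bs ! j\<close>, which form a unit vector.\<close>

lemma basis_change_inverse:
  assumes bs: "is_rat_basis K bs" and cs: "is_rat_basis K cs"
  shows "basis_change bs cs * basis_change cs bs = 1\<^sub>m (length bs)"
proof (rule eq_matI)
  fix i j assume "i < dim_row (1\<^sub>m (length bs) :: rat mat)" "j < dim_col (1\<^sub>m (length bs) :: rat mat)"
  then have ij: "i < length bs" "j < length bs"
    by auto
  let ?c = "\<lambda>k. rat_vs.representation (set cs) (bs ! j) (cs ! k)"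
  have "rat_vs.representation (set bs) (bs ! j) (bs ! i)
      = rat_vs.representation (set bs) (\<Sum>k = 0..<length cs. rat_scale (?c k) (cs ! k)) (bs ! i)"
    using rat_basis_expansion[OF cs rat_basis_nth_mem[OF bs ij(2)]] by simp
  also have "\<dots> = (\<Sum>k = 0..<length cs. ?c k * rat_vs.representation (set bs) (cs ! k) (bs ! i))"
    by (rule rat_basis_representation_sum[OF bs]) (simp add: rat_basis_nth_mem[OF cs])
  finally have "(basis_change bs cs * basis_change cs bs) $$ (i, j)
      = rat_vs.representation (set bs) (bs ! j) (bs ! i)"
    using ij by (simp add: basis_change_def scalar_prod_def mult.commute)
  \<comment> \<open>Distinctness of \<open>bs\<close> turns equality of basis vectors into equality
    of indices.\<close>
  also have "\<dots> = (1\<^sub>m (length bs) :: rat mat) $$ (i, j)"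
    using bs ij by (auto simp: rat_vs.representation_basis is_rat_basis_def nth_eq_iff_index_eq)
  finally show "(basis_change bs cs * basis_change cs bs) $$ (i, j) = (1\<^sub>m (length bs) :: rat mat) $$ (i, j)" .
qed (simp_all add: basis_change_def)

text \<open>Both entries at \<open>(i, j)\<close> are the \<open>bs ! i\<close>-coordinate of
  \<open>\<alpha> * cs ! j\<close>: on the left \<open>cs ! j\<close> is expanded in
  \<open>bs\<close> before multiplying, on the right the product is expanded in
  \<open>cs\<close>.\<close>

lemma mult_matrix_basis_change:
  assumes bs: "is_rat_basis K bs" and cs: "is_rat_basis K cs"
    and closed: "\<And>x. x \<in> K \<Longrightarrow> \<alpha> * x \<in> K"
  shows "mult_matrix bs \<alpha> * basis_change bs cs = basis_change bs cs * mult_matrix cs \<alpha>"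
proof (rule eq_matI)
  fix i j assume "i < dim_row (basis_change bs cs * mult_matrix cs \<alpha>)"
    "j < dim_col (basis_change bs cs * mult_matrix cs \<alpha>)"
  then have ij: "i < length bs" "j < length cs"
    by (auto simp: basis_change_def mult_matrix_def)
  let ?b = "\<lambda>k. rat_vs.representation (set bs) (cs ! j) (bs ! k)"
  let ?c = "\<lambda>k. rat_vs.representation (set cs) (\<alpha> * cs ! j) (cs ! k)"
  have "\<alpha> * cs ! j = \<alpha> * (\<Sum>k = 0..<length bs. rat_scale (?b k) (bs ! k))"
    using rat_basis_expansion[OF bs rat_basis_nth_mem[OF cs ij(2)]] by simp
  also have "\<dots> = (\<Sum>k = 0..<length bs. rat_scale (?b k) (\<alpha> * bs ! k))"
    by (simp add: sum_distrib_left rat_scale_def ac_simps)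
  finally have "rat_vs.representation (set bs) (\<alpha> * cs ! j) (bs ! i)
      = rat_vs.representation (set bs) (\<Sum>k = 0..<length bs. rat_scale (?b k) (\<alpha> * bs ! k)) (bs ! i)"
    by simp
  also have "\<dots> = (\<Sum>k = 0..<length bs. ?b k * rat_vs.representation (set bs) (\<alpha> * bs ! k) (bs ! i))"
    by (rule rat_basis_representation_sum[OF bs]) (simp add: closed rat_basis_nth_mem[OF bs])
  finally have 1: "(mult_matrix bs \<alpha> * basis_change bs cs) $$ (i, j)
      = rat_vs.representation (set bs) (\<alpha> * cs ! j) (bs ! i)"
    using ij by (simp add: basis_change_def mult_matrix_def scalar_prod_def mult.commute)
  have "rat_vs.representation (set bs) (\<alpha> * cs ! j) (bs ! i)
      = rat_vs.representation (set bs) (\<Sum>k = 0..<length cs. rat_scale (?c k) (cs ! k)) (bs ! i)"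
    using rat_basis_expansion[OF cs closed[OF rat_basis_nth_mem[OF cs ij(2)]]] by simp
  also have "\<dots> = (\<Sum>k = 0..<length cs. ?c k * rat_vs.representation (set bs) (cs ! k) (bs ! i))"
    by (rule rat_basis_representation_sum[OF bs]) (simp add: rat_basis_nth_mem[OF cs])
  finally show "(mult_matrix bs \<alpha> * basis_change bs cs) $$ (i, j)
      = (basis_change bs cs * mult_matrix cs \<alpha>) $$ (i, j)"
    unfolding 1 using ij by (simp add: basis_change_def mult_matrix_def scalar_prod_def mult.commute)
qed (simp_all add: basis_change_def mult_matrix_def)

text \<open>The two matrices are similar. It suffices to take determinants of the intertwining
  relation and cancel \<open>det ?P\<close>, which is nonzero because \<open>?P * ?Q\<close> is the
  identity.\<close>

lemma det_mult_matrix_basis_independent: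
  assumes bs: "is_rat_basis K bs" and cs: "is_rat_basis K cs"
    and closed: "\<And>x. x \<in> K \<Longrightarrow> \<alpha> * x \<in> K"
  shows "det (mult_matrix bs \<alpha>) = det (mult_matrix cs \<alpha>)"
proof -
  let ?n = "length bs"
  let ?P = "basis_change bs cs" and ?Q = "basis_change cs bs"
  have len: "length cs = ?n"
    using rat_basis_length_eq[OF bs cs] by simp
  have carrier: "?P \<in> carrier_mat ?n ?n" "?Q \<in> carrier_mat ?n ?n"
    "mult_matrix bs \<alpha> \<in> carrier_mat ?n ?n" "mult_matrix cs \<alpha> \<in> carrier_mat ?n ?n"
    by (simp_all add: basis_change_def mult_matrix_def len)
  have "det ?P * det ?Q = 1"
    using basis_change_inverse[OF bs cs] det_mult[OF carrier(1,2)] by simp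
  then have "det ?P \<noteq> 0"
    by auto
  moreover have "mult_matrix bs \<alpha> * ?P = ?P * mult_matrix cs \<alpha>"
    by (rule mult_matrix_basis_change[OF bs cs closed])
  then have "det (mult_matrix bs \<alpha>) * det ?P = det ?P * det (mult_matrix cs \<alpha>)"
    using det_mult[OF carrier(3,1)] det_mult[OF carrier(1,4)] by metis
  ultimately show ?thesis
    by simp
qed

section \<open>Explicit small determinants, and the norm computed in a chosen basis\<close>

lemma det_carrier_mat_2:
  assumes "A \<in> carrier_mat 2 2"
  shows "det A = A $$ (0, 0) * A $$ (1, 1) - A $$ (1, 0) * A $$ (0, 1)"
proof -
  have "det A = (\<Sum>i<2. A $$ (i, 0) * cofactor A i 0)"
    by (rule laplace_expansion_column[OF assms]) simp
  then show ?thesis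
    using assms by (simp add: cofactor_def numeral_2_eq_2 det_single mat_delete_def)
qed

lemma det_carrier_mat_3:
  assumes "A \<in> carrier_mat 3 3"
  shows "det A =
    A $$ (0, 0) * (A $$ (1, 1) * A $$ (2, 2) - A $$ (2, 1) * A $$ (1, 2))
    - A $$ (1, 0) * (A $$ (0, 1) * A $$ (2, 2) - A $$ (2, 1) * A $$ (0, 2))
    + A $$ (2, 0) * (A $$ (0, 1) * A $$ (1, 2) - A $$ (1, 1) * A $$ (0, 2))"
proof -
  have minor: "mat_delete A i 0 \<in> carrier_mat 2 2" for i
    using assms by (simp add: mat_delete_def)
  have "det A = (\<Sum>i<3. A $$ (i, 0) * cofactor A i 0)"
    by (rule laplace_expansion_column[OF assms]) simp
  then show ?thesis
    using assms unfolding cofactor_def det_carrier_mat_2[OF minor]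
    by (simp add: numeral_3_eq_3 numeral_2_eq_2 mat_delete_def right_diff_distrib)
qed

text \<open>As soon as one basis exists, the list picked by \<open>SOME\<close> is a genuine basis,
  and basis independence replaces it by \<open>bs\<close>.\<close>

lemma field_norm_eq_det:
  assumes "is_rat_basis K bs" and "\<And>x. x \<in> K \<Longrightarrow> \<alpha> * x \<in> K"
  shows "field_norm K \<alpha> = det (mult_matrix bs \<alpha>)"
  unfolding field_norm_def
  using det_mult_matrix_basis_independent[OF _ assms] someI[of "is_rat_basis K", OF assms(1)] by blast

section \<open>Pure cubic fields\<close>

text \<open>\<open>is_subfield\<close> provides differences only, hence the detour through
  \<open>x - (0 - y)\<close>.\<close>

lemma subfield_add:
  assumes "is_subfield F" "x \<in> F" "y \<in> F"
  shows "x + y \<in> F"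
proof -
  have "x - (0 - y) \<in> F"
    using assms unfolding is_subfield_def by blast
  then show ?thesis
    by simp
qed

lemma subfield_of_rat:
  assumes F: "is_subfield F"
  shows "of_rat q \<in> F"
proof -
  have nat: "of_nat n \<in> F" for n
    by (induction n) (use F subfield_add[OF F] in \<open>auto simp: is_subfield_def\<close>)
  have int: "of_int k \<in> F" for k
  proof (cases k rule: int_cases2)
    case (nonpos n)
    have "0 - of_nat n \<in> F"
      using nat[of n] F unfolding is_subfield_def by blast
    then show ?thesis
      using nonpos by simp
  qed (use nat in auto)
  obtain n d where "q = of_int n / of_int d"
    using quotient_of_div by (metis surj_pair)
  then have "of_rat q = (of_int n * inverse (of_int d) :: 'a)"
    by (simp add: of_rat_mult of_rat_inverse field_class.field_divide_inverse)
  then show ?thesis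
    using F int unfolding is_subfield_def by simp
qed

locale pure_cubic =
  fixes m :: int and \<omega> :: "'a::field_char_0"
  assumes not_cube: "\<nexists>k::int. m = k ^ 3"
    and omega: "\<omega> ^ 3 = of_int m"
begin

section \<open>Coordinates with respect to 1, \<omega> and \<omega> squared\<close>

definition elt :: "rat \<Rightarrow> rat \<Rightarrow> rat \<Rightarrow> 'a" where
  "elt r s t = of_rat r + of_rat s * \<omega> + of_rat t * \<omega> ^ 2"

lemma rat_cube_neq: "q ^ 3 \<noteq> of_int m" for q :: rat
  using rat_cube_eq_int not_cube by blast

text \<open>The hypotheses give \<open>t ^ 3 * m = r * s * t = s ^ 3\<close>, so
  \<open>t \<noteq> 0\<close> would make \<open>s / t\<close> a rational cube root of
  \<open>m\<close>. They arise both in the proof of linear independence and when the norm form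
  vanishes.\<close>

lemma coeff_eq_0:
  fixes r s t :: rat
  assumes "s ^ 2 = r * t" "t ^ 2 * of_int m = r * s"
  shows "t = 0"
proof (rule ccontr)
  assume t: "t \<noteq> 0"
  have "t ^ 3 * of_int m = s ^ 3"
    using assms by Groebner_Basis.algebra
  then have "(s / t) ^ 3 = of_int m"
    using t by (simp add: power_divide field_simps)
  then show False
    using rat_cube_neq by blast
qed

lemma omega_not_rat: "\<omega> \<noteq> of_rat q"
proof
  assume "\<omega> = of_rat q"
  then have "of_rat (q ^ 3) = (of_rat (of_int m) :: 'a)"
    using omega by (simp add: of_rat_power)
  then show False
    using rat_cube_neq by (simp only: of_rat_eq_iff)
qed

lemma linear_eq_0:
  assumes "of_rat p + of_rat q * \<omega> = 0"
  shows "q = 0"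
proof (rule ccontr)
  assume "q \<noteq> 0"
  then have "\<omega> = of_rat (- p / q)"
    using assms by (simp add: of_rat_divide of_rat_minus field_simps eq_neg_iff_add_eq_0)
  then show False
    using omega_not_rat by blast
qed

text \<open>Linear independence by elimination: multiplying the relation by
  \<open>t * \<omega> - s\<close> removes \<open>\<omega> ^ 2\<close>, and irrationality of \<omega>
  then kills both remaining coefficients, which is the input of \<open>coeff_eq_0\<close>.\<close>

lemma elt_eq_0:
  assumes "elt r s t = 0"
  shows "r = 0 \<and> s = 0 \<and> t = 0"
proof -
  have 0: "of_rat r + of_rat s * \<omega> + of_rat t * \<omega> ^ 2 = 0"
    using assms by (simp add: elt_def)
  \<comment> \<open>The left-hand side is \<open>(T * w - S) * (R + S * w + T * w ^ 2)\<close> reduced modulo \<open>w ^ 3 = M\<close>.\<close>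
  have reduce: "T ^ 2 * M - R * S + (R * T - S ^ 2) * w = 0"
    if "R + S * w + T * w ^ 2 = 0" "w ^ 3 = M" for R S T M w :: 'a
    using that by Groebner_Basis.algebra
  have "of_rat (t ^ 2 * of_int m - r * s) + of_rat (r * t - s ^ 2) * \<omega> = 0"
    using reduce[OF 0 omega] by (simp add: of_rat_diff of_rat_mult of_rat_power)
  then have s: "s ^ 2 = r * t" and "of_rat (t ^ 2 * of_int m - r * s) = (0::'a)"
    using linear_eq_0[of "t ^ 2 * of_int m - r * s" "r * t - s ^ 2"] by auto
  then have m: "t ^ 2 * of_int m = r * s"
    by (simp only: of_rat_eq_0_iff right_minus_eq)
  have "t = 0"
    using s m by (rule coeff_eq_0)
  then show ?thesis
    using s 0 by simp
qed

lemma elt_diff: "elt r s t - elt r' s' t' = elt (r - r') (s - s') (t - t')"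
  by (simp add: elt_def of_rat_diff algebra_simps)

lemma elt_eq_iff: "elt r s t = elt r' s' t' \<longleftrightarrow> r = r' \<and> s = s' \<and> t = t'"
  using elt_eq_0[of "r - r'" "s - s'" "t - t'"] elt_diff[of r s t r' s' t'] by auto

lemma elt_mult:
  "elt r s t * elt r' s' t' =
     elt (r * r' + of_int m * (s * t' + t * s')) (r * s' + s * r' + of_int m * t * t')
       (r * t' + s * s' + t * r')"
  \<comment> \<open>Writing \<open>m\<close> as \<open>\<omega> ^ 3\<close> turns the reduction of
    higher powers into a plain polynomial identity in \<omega>.\<close>
  unfolding elt_def of_rat_add of_rat_mult of_rat_of_int_eq omega[symmetric]
  by (simp add: algebra_simps power2_eq_square power3_eq_cube)

lemma elt_square:
  "elt r s t ^ 2 = elt (r ^ 2 + 2 * of_int m * s * t) (2 * r * s + of_int m * t ^ 2) (s ^ 2 + 2 * r * t)"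
  unfolding power2_eq_square elt_mult elt_eq_iff by (simp add: algebra_simps)

section \<open>Inverses, and the field \<open>K\<close> in coordinates\<close>

lemma rat_eq_elt: "of_rat q = elt q 0 0"
  by (simp add: elt_def)

lemma rat_minus_rat_omega_eq_elt: "of_rat a - of_rat b * \<omega> = elt a (- b) 0"
  by (simp add: elt_def of_rat_minus)

text \<open>The second factor is the product of the other two conjugates of
  \<open>elt r s t\<close>, written without cube roots of unity. The identity is the factorisation
  of \<open>A ^ 3 + B ^ 3 + C ^ 3 - 3 * A * B * C\<close> at \<open>A = r\<close>,
  \<open>B = s * \<omega>\<close>, \<open>C = t * \<omega> ^ 2\<close>.\<close>

lemma elt_times_adjugate:
  "elt r s t * elt (r ^ 2 - of_int m * s * t) (of_int m * t ^ 2 - r * s) (s ^ 2 - r * t)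
     = of_rat (r ^ 3 + of_int m * s ^ 3 + of_int m ^ 2 * t ^ 3 - 3 * of_int m * r * s * t)"
  unfolding elt_mult rat_eq_elt elt_eq_iff by (auto simp: algebra_simps power2_eq_square power3_eq_cube)

lemma inverse_elt: "inverse (elt r s t) \<in> range (\<lambda>(r, s, t). elt r s t)"
proof (cases "elt r s t = 0")
  case True
  have "elt 0 0 0 = (0::'a)"
    by (simp add: elt_def)
  then show ?thesis
    using True by (force simp: image_iff)
next
  case False
  let ?N = "r ^ 3 + of_int m * s ^ 3 + of_int m ^ 2 * t ^ 3 - 3 * of_int m * r * s * t :: rat"
  let ?r = "r ^ 2 - of_int m * s * t" and ?s = "of_int m * t ^ 2 - r * s" and ?t = "s ^ 2 - r * t"
  have prod: "elt r s t * elt ?r ?s ?t = of_rat ?N"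
    by (rule elt_times_adjugate)
  \<comment> \<open>If the norm form vanished, the cofactor would be 0, as a field has no zero
    divisors; its coordinates are exactly the relations handled by
    \<open>coeff_eq_0\<close>.\<close>
  have N: "?N \<noteq> 0"
  proof
    assume "?N = 0"
    then have "elt ?r ?s ?t = 0"
      using prod False by simp
    then have *: "r ^ 2 = of_int m * s * t" "of_int m * t ^ 2 = r * s" "s ^ 2 = r * t"
      using elt_eq_0[of ?r ?s ?t] by auto
    have "t = 0"
      using *(3) by (rule coeff_eq_0) (use *(2) in \<open>simp add: mult.commute\<close>)
    then have "elt r s t = 0"
      using * by (simp add: elt_def)
    then show False
      using False by simp
  qed
  have "elt r s t * (of_rat (1 / ?N) * elt ?r ?s ?t) = of_rat (1 / ?N) * of_rat ?N"
    using prod by (simp add: ac_simps)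
  also have "\<dots> = 1"
    unfolding of_rat_mult[symmetric] using N by simp
  finally have "inverse (elt r s t) = of_rat (1 / ?N) * elt ?r ?s ?t"
    by (rule inverse_unique)
  then have "inverse (elt r s t) = (case (1 / ?N * ?r, 1 / ?N * ?s, 1 / ?N * ?t) of (r, s, t) \<Rightarrow> elt r s t)"
    unfolding rat_eq_elt[of "1 / ?N"] elt_mult by simp
  then show ?thesis
    by (rule range_eqI)
qed

lemma subfield_range_elt: "is_subfield (range (\<lambda>(r, s, t). elt r s t))"
  unfolding is_subfield_def
proof (intro conjI ballI)
  show "0 \<in> range (\<lambda>(r, s, t). elt r s t)"
    by (rule range_eqI[of _ _ "(0, 0, 0)"]) (simp add: elt_def)
  show "1 \<in> range (\<lambda>(r, s, t). elt r s t)"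
    by (rule range_eqI[of _ _ "(1, 0, 0)"]) (simp add: elt_def)
next
  fix x y assume "x \<in> range (\<lambda>(r, s, t). elt r s t)" "y \<in> range (\<lambda>(r, s, t). elt r s t)"
  then obtain r s t r' s' t' where xy: "x = elt r s t" "y = elt r' s' t'"
    by auto
  show "x - y \<in> range (\<lambda>(r, s, t). elt r s t)"
    unfolding xy elt_diff by (rule range_eqI[of _ _ "(_, _, _)"]) simp
  show "x * y \<in> range (\<lambda>(r, s, t). elt r s t)"
    unfolding xy elt_mult by (rule range_eqI[of _ _ "(_, _, _)"]) simp
next
  fix x assume "x \<in> range (\<lambda>(r, s, t). elt r s t)"
  then show "inverse x \<in> range (\<lambda>(r, s, t). elt r s t)"
    using inverse_elt by auto
qed

text \<open>The range is itself one of the subfields being intersected, and each of those contains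
  the rationals and \<omega>, hence the whole range.\<close>

lemma rat_adjoin_eq: "rat_adjoin \<omega> = range (\<lambda>(r, s, t). elt r s t)"
proof
  have "\<omega> \<in> range (\<lambda>(r, s, t). elt r s t)"
    by (rule range_eqI[of _ _ "(0, 1, 0)"]) (simp add: elt_def)
  then show "rat_adjoin \<omega> \<subseteq> range (\<lambda>(r, s, t). elt r s t)"
    using subfield_range_elt unfolding rat_adjoin_def by blast
next
  have "elt r s t \<in> F" if F: "is_subfield F" "\<omega> \<in> F" for r s t F
    using F subfield_of_rat[OF F(1)] unfolding elt_def is_subfield_def power2_eq_square
    by (intro subfield_add[OF F(1)]) blast+
  then show "range (\<lambda>(r, s, t). elt r s t) \<subseteq> rat_adjoin \<omega>"
    unfolding rat_adjoin_def by auto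
qed

lemma elt_mem [simp]: "elt r s t \<in> rat_adjoin \<omega>"
  unfolding rat_adjoin_eq by (rule range_eqI[of _ _ "(r, s, t)"]) simp

lemma mem_rat_adjoinE:
  assumes "\<alpha> \<in> rat_adjoin \<omega>"
  obtains r s t where "\<alpha> = elt r s t"
  using assms unfolding rat_adjoin_eq by auto

section \<open>The power basis and the norm form\<close>

definition power_basis :: "'a list" where
  "power_basis = [1, \<omega>, \<omega> ^ 2]"

lemma distinct_power_basis: "distinct power_basis"
proof -
  have "1 = elt 1 0 0" "\<omega> = elt 0 1 0" "\<omega> ^ 2 = elt 0 0 1"
    by (simp_all add: elt_def)
  then show ?thesis
    unfolding power_basis_def by (metis distinct_length_2_or_more distinct_singleton elt_eq_iff zero_neq_one)
qed

text \<open>Distinctness keeps the three summands apart. Independence, span and representation all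
  reduce to coordinates through this formula.\<close>

lemma sum_power_basis: "(\<Sum>v\<in>set power_basis. rat_scale (u v) v) = elt (u 1) (u \<omega>) (u (\<omega> ^ 2))"
  using distinct_power_basis by (simp add: power_basis_def elt_def rat_scale_def add.assoc)

lemma independent_power_basis: "rat_vs.independent (set power_basis)"
proof
  assume "rat_vs.dependent (set power_basis)"
  then obtain u where "\<exists>v\<in>set power_basis. u v \<noteq> 0"
    "(\<Sum>v\<in>set power_basis. rat_scale (u v) v) = 0"
    by (auto simp: rat_vs.dependent_finite)
  then show False
    using elt_eq_0[of "u 1" "u \<omega>" "u (\<omega> ^ 2)"] unfolding sum_power_basis by (auto simp: power_basis_def)
qed

lemma span_power_basis: "rat_vs.span (set power_basis) = rat_adjoin \<omega>"
proof -
  have "elt r s t \<in> range (\<lambda>u. \<Sum>v\<in>set power_basis. rat_scale (u v) v)" for r s t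
  proof (rule range_eqI)
    show "elt r s t = (\<Sum>v\<in>set power_basis.
        rat_scale ((if v = 1 then r else if v = \<omega> then s else t)) v)"
      unfolding sum_power_basis using distinct_power_basis by (auto simp: power_basis_def)
  qed
  then show ?thesis
    by (auto simp: rat_vs.span_finite sum_power_basis elim: mem_rat_adjoinE)
qed

lemma is_rat_basis_power_basis: "is_rat_basis (rat_adjoin \<omega>) power_basis"
  using distinct_power_basis independent_power_basis span_power_basis by (simp add: is_rat_basis_def)

lemma representation_elt:
  assumes "i < 3"
  shows "rat_vs.representation (set power_basis) (elt r s t) (power_basis ! i) = [r, s, t] ! i"
proof -
  let ?R = "rat_vs.representation (set power_basis) (elt r s t)"
  have "(\<Sum>v\<in>set power_basis. rat_scale (?R v) v) = elt r s t"
    by (rule rat_vs.sum_representation_eq[OF independent_power_basis])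
      (simp_all add: span_power_basis)
  then have "?R 1 = r \<and> ?R \<omega> = s \<and> ?R (\<omega> ^ 2) = t"
    unfolding sum_power_basis elt_eq_iff .
  then show ?thesis
    using assms by (auto simp: power_basis_def less_Suc_eq numeral_eq_Suc)
qed

lemma field_norm_elt:
  "field_norm (rat_adjoin \<omega>) (elt r s t)
    = r ^ 3 + of_int m * s ^ 3 + of_int m ^ 2 * t ^ 3 - 3 * of_int m * r * s * t"
proof -
  \<comment> \<open>The matrix is listed by columns: the \<open>j\<close>-th list holds the
    coordinates of \<open>elt r s t * \<omega> ^ j\<close>, where \<open>\<omega> ^ 3 = m\<close>
    produces the factors \<open>m\<close>.\<close>
  let ?cols = "[[r, s, t], [of_int m * t, r, s], [of_int m * s, of_int m * t, r]]"
  let ?M = "mult_matrix power_basis (elt r s t)"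
  have carrier: "?M \<in> carrier_mat 3 3"
    by (simp add: mult_matrix_def power_basis_def numeral_eq_Suc)
  have basis: "power_basis ! 0 = elt 1 0 0" "power_basis ! Suc 0 = elt 0 1 0"
    "power_basis ! Suc (Suc 0) = elt 0 0 1"
    by (simp_all add: power_basis_def elt_def)
  have entry: "?M $$ (i, j) = ?cols ! j ! i" if ij: "i < 3" "j < 3" for i j
  proof -
    have "elt r s t * power_basis ! j = elt (?cols ! j ! 0) (?cols ! j ! 1) (?cols ! j ! 2)"
      using ij(2) by (auto simp: less_Suc_eq numeral_eq_Suc basis elt_mult)
    then have "?M $$ (i, j) = [?cols ! j ! 0, ?cols ! j ! 1, ?cols ! j ! 2] ! i"
      using ij representation_elt[OF ij(1)] by (simp add: mult_matrix_def power_basis_def)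
    then show ?thesis
      using ij by (auto simp: less_Suc_eq numeral_eq_Suc)
  qed
  have "elt r s t * x \<in> rat_adjoin \<omega>" if "x \<in> rat_adjoin \<omega>" for x
    using that by (auto simp: elt_mult elim: mem_rat_adjoinE)
  then have "field_norm (rat_adjoin \<omega>) (elt r s t) = det ?M"
    by (rule field_norm_eq_det[OF is_rat_basis_power_basis])
  also have "\<dots> = r ^ 3 + of_int m * s ^ 3 + of_int m ^ 2 * t ^ 3 - 3 * of_int m * r * s * t"
    unfolding det_carrier_mat_3[OF carrier] by (simp add: entry)
      (simp add: algebra_simps power2_eq_square power3_eq_cube)
  finally show ?thesis .
qed

end

section \<open>Square roots and points on the twisted curve\<close>

lemma (in pure_cubic) elt_square_eq_iff:
  "elt r s t ^ 2 = of_rat a - of_rat b * \<omega> \<longleftrightarrow>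
     a = r ^ 2 + 2 * of_int m * s * t \<and> b = - (2 * r * s + of_int m * t ^ 2) \<and> s ^ 2 + 2 * r * t = 0"
  unfolding elt_square rat_minus_rat_omega_eq_elt elt_eq_iff by auto

text \<open>In characteristic 0, \<open>y = - y\<close> would force \<open>y = 0\<close>, so the
  addition law takes its tangent branch.\<close>

lemma ec_add_self:
  fixes x y A :: "'k::field_char_0"
  assumes "y \<noteq> 0"
  shows "ec_add A (Affine x y) (Affine x y) =
    (let l = (3 * x ^ 2 + A) / (2 * y); x' = l ^ 2 - 2 * x in Affine x' (l * (x - x') - y))"
proof -
  have "y \<noteq> - y"
    using assms by (simp add: eq_neg_iff_add_eq_0 mult_2[symmetric])
  then show ?thesis
    by (simp add: Let_def algebra_simps)
qed

text \<open>The tangent of slope \<open>l\<close> meets the cubic twice at \<open>x\<close> and once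
  more at \<open>x'\<close>. With the slope equation cleared of denominators, both claims are
  polynomial consequences of it and the curve equation.\<close>

lemma double_on_curve:
  fixes x y B :: "'k::field_char_0"
  assumes "y ^ 2 = x ^ 3 + B" "y \<noteq> 0"
  defines "l \<equiv> 3 * x ^ 2 / (2 * y)"
  defines "x' \<equiv> l ^ 2 - 2 * x"
  shows "(l * (x - x') - y) ^ 2 = x' ^ 3 + B" and "x' = (x ^ 4 - 8 * B * x) / (4 * y ^ 2)"
proof -
  have l: "2 * y * l = 3 * x ^ 2"
    using assms(2) by (simp add: l_def)
  have x': "x' = l ^ 2 - 2 * x"
    by (simp add: x'_def)
  \<comment> \<open>This gives \<open>4 * y ^ 2 * x' = 9 * x ^ 4 - 8 * x * y ^ 2\<close>, where
    \<open>y ^ 2\<close> is then replaced by \<open>x ^ 3 + B\<close>.\<close>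
  have "(2 * y * l) ^ 2 = 9 * x ^ 4"
    unfolding l by (simp add: power_mult_distrib flip: power_mult)
  then have "4 * y ^ 2 * x' = x ^ 4 - 8 * B * x"
    using x' assms(1) by Groebner_Basis.algebra
  then show "x' = (x ^ 4 - 8 * B * x) / (4 * y ^ 2)"
    using assms(2) by (simp add: field_simps)
  show "(l * (x - x') - y) ^ 2 = x' ^ 3 + B"
    using l x' assms(1) by Groebner_Basis.algebra
qed

section \<open>The explicit correspondence between square roots and affine points\<close>

locale twisted_cubic = pure_cubic m \<omega> for m :: int and \<omega> :: "'a::field_char_0" +
  fixes b B :: rat
  assumes b_nonzero: "b \<noteq> 0"
    and B_def: "B = - of_int m * b ^ 3"
begin

definition roots :: "'a set" where
  "roots = {\<alpha> \<in> rat_adjoin \<omega>. \<alpha> \<noteq> 0 \<and> (\<exists>a::rat. \<alpha> ^ 2 = of_rat a - of_rat b * \<omega>)}"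

text \<open>The description is proper for \<alpha> in \<open>K\<close>, where coordinates are unique
  by \<open>elt_eq_iff\<close>.\<close>

definition root_point :: "'a \<Rightarrow> rat ec_point" where
  "root_point \<alpha> = (THE P. \<exists>r s t. \<alpha> = elt r s t \<and> P = Affine (b * s / t) (b ^ 2 / t))"

text \<open>Solving \<open>y = b ^ 2 / t\<close> and \<open>x = b * s / t\<close> gives
  \<open>t\<close> and \<open>s\<close>; then \<open>r = - (s ^ 2) / (2 * t)\<close>. The value at
  \<open>Infinity\<close> is a filler.\<close>

fun point_root :: "rat ec_point \<Rightarrow> 'a" where
  "point_root (Affine x y) = elt (- (x ^ 2) / (2 * y)) (b * x / y) (b ^ 2 / y)"
| "point_root Infinity = 0"

lemma m_nonzero: "m \<noteq> 0"
  using not_cube by (metis power_zero_numeral)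

lemma root_point_elt: "root_point (elt r s t) = Affine (b * s / t) (b ^ 2 / t)"
  unfolding root_point_def by (rule the_equality) (auto simp: elt_eq_iff)

lemma root_nonzero: "of_rat a - of_rat b * \<omega> \<noteq> 0"
  using elt_eq_0[of a "- b" 0] b_nonzero unfolding rat_minus_rat_omega_eq_elt by auto

lemma mem_rootsI:
  assumes "elt r s t ^ 2 = of_rat a - of_rat b * \<omega>"
  shows "elt r s t \<in> roots"
  using assms root_nonzero[of a] unfolding roots_def by auto

lemma mem_rootsE:
  assumes "\<alpha> \<in> roots"
  obtains r s t a where "\<alpha> = elt r s t" "elt r s t ^ 2 = of_rat a - of_rat b * \<omega>"
  using assms unfolding roots_def by (auto elim: mem_rat_adjoinE)

lemma affine_mem_iff: "Affine x y \<in> ec_affine_points 0 B \<longleftrightarrow> y ^ 2 = x ^ 3 - of_int m * b ^ 3"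
  by (simp add: ec_affine_points_def B_def)

text \<open>The curve has no rational 2-torsion: at \<open>y = 0\<close> the quotient
  \<open>x / b\<close> would be a rational cube root of \<open>m\<close>.\<close>

lemma affine_y_nonzero:
  assumes "Affine x y \<in> ec_affine_points 0 B"
  shows "y \<noteq> 0"
proof
  assume "y = 0"
  then have "x ^ 3 = of_int m * b ^ 3"
    using assms by (simp add: affine_mem_iff)
  then have "(x / b) ^ 3 = of_int m"
    using b_nonzero by (simp add: power_divide)
  then show False
    using rat_cube_neq by blast
qed

text \<open>If \<open>t = 0\<close>, then \<open>s ^ 2 + 2 * r * t = 0\<close> forces
  \<open>s = 0\<close>, and the \<omega>-coefficient gives \<open>b = 0\<close>.\<close>

lemma root_t_nonzero:
  assumes "elt r s t ^ 2 = of_rat a - of_rat b * \<omega>"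
  shows "t \<noteq> 0"
  using assms b_nonzero unfolding elt_square_eq_iff by auto

lemma root_point_mem:
  assumes sq: "elt r s t ^ 2 = of_rat a - of_rat b * \<omega>"
  shows "root_point (elt r s t) \<in> ec_affine_points 0 B"
proof -
  have t: "t \<noteq> 0"
    using root_t_nonzero[OF sq] .
  have "b = - (2 * r * s + of_int m * t ^ 2)" "s ^ 2 + 2 * r * t = 0"
    using sq by (auto simp: elt_square_eq_iff)
  \<comment> \<open>Multiply the formula for \<open>b\<close> by \<open>t\<close> and substitute
    \<open>2 * r * t = - (s ^ 2)\<close>.\<close>
  then have "b * t = s ^ 3 - of_int m * t ^ 3"
    by Groebner_Basis.algebra
  \<comment> \<open>The factor \<open>b ^ 3\<close> is chosen so that division by
    \<open>t ^ 3\<close> yields the Weierstrass equation.\<close>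
  then have "b ^ 4 * t = b ^ 3 * (s ^ 3 - of_int m * t ^ 3)"
    by Groebner_Basis.algebra
  then have "(b ^ 2 / t) ^ 2 = (b * s / t) ^ 3 - of_int m * b ^ 3"
    using t by (simp add: field_simps power2_eq_square power3_eq_cube power4_eq_xxxx)
  then show ?thesis
    by (simp add: root_point_elt affine_mem_iff)
qed

lemma point_root_square:
  assumes P: "Affine x y \<in> ec_affine_points 0 B"
  shows "point_root (Affine x y) ^ 2 =
    of_rat ((x ^ 4 + 8 * of_int m * b ^ 3 * x) / (4 * y ^ 2)) - of_rat b * \<omega>"
proof -
  have y: "y \<noteq> 0"
    using affine_y_nonzero[OF P] .
  have curve: "y ^ 2 = x ^ 3 - of_int m * b ^ 3"
    using P by (simp add: affine_mem_iff)
  \<comment> \<open>Over the denominator \<open>y ^ 2\<close>, the \<omega>-coefficient of the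
    square has numerator \<open>m * b ^ 4 - b * x ^ 3\<close>, which this identifies with
    \<open>- b * y ^ 2\<close>.\<close>
  have "b * y ^ 2 = b * x ^ 3 - of_int m * b ^ 4"
    unfolding curve by (simp add: algebra_simps power4_eq_xxxx power3_eq_cube)
  then have "b = - (2 * (- (x ^ 2) / (2 * y)) * (b * x / y) + of_int m * (b ^ 2 / y) ^ 2)"
    using y by (simp add: field_simps power2_eq_square power3_eq_cube power4_eq_xxxx)
  moreover have "(x ^ 4 + 8 * of_int m * b ^ 3 * x) / (4 * y ^ 2)
      = (- (x ^ 2) / (2 * y)) ^ 2 + 2 * of_int m * (b * x / y) * (b ^ 2 / y)"
    using y by (simp add: field_simps power2_eq_square power3_eq_cube power4_eq_xxxx)
  moreover have "(b * x / y) ^ 2 + 2 * (- (x ^ 2) / (2 * y)) * (b ^ 2 / y) = 0"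
    using y by (simp add: field_simps power2_eq_square)
  ultimately show ?thesis
    unfolding point_root.simps elt_square_eq_iff by blast
qed

lemma point_root_mem:
  assumes "Affine x y \<in> ec_affine_points 0 B"
  shows "point_root (Affine x y) \<in> roots"
  using point_root_square[OF assms] mem_rootsI by simp

lemma root_point_point_root:
  assumes "Affine x y \<in> ec_affine_points 0 B"
  shows "root_point (point_root (Affine x y)) = Affine x y"
  using affine_y_nonzero[OF assms] b_nonzero
  by (simp add: root_point_elt power2_eq_square)

text \<open>The point records only \<open>s\<close> and \<open>t\<close>; the vanishing
  \<omega>-squared coefficient recovers \<open>r\<close>, as \<open>t \<noteq> 0\<close>.\<close>

lemma point_root_root_point:
  assumes sq: "elt r s t ^ 2 = of_rat a - of_rat b * \<omega>"
  shows "point_root (root_point (elt r s t)) = elt r s t"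
proof -
  have t: "t \<noteq> 0"
    using root_t_nonzero[OF sq] .
  have "2 * r * t = - (s ^ 2)"
    using sq by (simp add: elt_square_eq_iff eq_neg_iff_add_eq_0 add.commute)
  then show ?thesis
    using t b_nonzero by (simp add: root_point_elt elt_eq_iff field_simps power2_eq_square)
qed

lemma bij_betw_root_point: "bij_betw root_point roots (ec_affine_points 0 B)"
proof (rule bij_betw_byWitness)
  show "\<forall>\<alpha>\<in>roots. point_root (root_point \<alpha>) = \<alpha>"
    using point_root_root_point by (auto elim: mem_rootsE)
  show "\<forall>P\<in>ec_affine_points 0 B. root_point (point_root P) = P"
    using root_point_point_root by (auto simp: ec_affine_points_def)
  show "root_point ` roots \<subseteq> ec_affine_points 0 B"
    using root_point_mem by (auto elim: mem_rootsE)
  show "point_root ` ec_affine_points 0 B \<subseteq> roots"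
    using point_root_mem by (auto simp: ec_affine_points_def)
qed

section \<open>Doubles of points and squares in \<open>K\<close>\<close>

lemma ec_double:
  assumes P: "Affine x y \<in> ec_affine_points 0 B"
  obtains y' where
    "ec_add 0 (Affine x y) (Affine x y) = Affine ((x ^ 4 + 8 * of_int m * b ^ 3 * x) / (4 * y ^ 2)) y'"
    "ec_add 0 (Affine x (- y)) (Affine x (- y)) =
      Affine ((x ^ 4 + 8 * of_int m * b ^ 3 * x) / (4 * y ^ 2)) (- y')"
    "Affine ((x ^ 4 + 8 * of_int m * b ^ 3 * x) / (4 * y ^ 2)) y' \<in> ec_affine_points 0 B"
proof -
  let ?l = "3 * x ^ 2 / (2 * y)"
  let ?x = "?l ^ 2 - 2 * x"
  let ?y = "?l * (x - ?x) - y"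
  have y: "y \<noteq> 0"
    using affine_y_nonzero[OF P] .
  have curve: "y ^ 2 = x ^ 3 + B"
    using P by (simp add: ec_affine_points_def)
  have x: "?x = (x ^ 4 + 8 * of_int m * b ^ 3 * x) / (4 * y ^ 2)"
    using double_on_curve(2)[OF curve y] by (simp add: B_def)
  have 1: "ec_add 0 (Affine x y) (Affine x y) = Affine ?x ?y"
    using ec_add_self[OF y, of 0 x] by (simp add: Let_def)
  \<comment> \<open>Negation commutes with doubling. Both signs are kept because the norm determines
    the second coordinate only up to sign.\<close>
  have 2: "ec_add 0 (Affine x (- y)) (Affine x (- y)) = Affine ?x (- ?y)"
    using ec_add_self[of "- y" 0 x] y by (simp add: Let_def)
  have "Affine ?x ?y \<in> ec_affine_points 0 B"
    using double_on_curve(1)[OF curve y] by (simp add: ec_affine_points_def)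
  then show thesis
    using that[of ?y] 1 2 unfolding x by blast
qed

lemma field_norm_rat_minus_rat_omega:
  "field_norm (rat_adjoin \<omega>) (of_rat a - of_rat b * \<omega>) = a ^ 3 - of_int m * b ^ 3"
  unfolding rat_minus_rat_omega_eq_elt field_norm_elt by simp

lemma square_iff_mem_ec_doubles:
  "(\<exists>\<beta>\<in>rat_adjoin \<omega>. \<beta> ^ 2 = of_rat a - of_rat b * \<omega>) \<and>
     field_norm (rat_adjoin \<omega>) (of_rat a - of_rat b * \<omega>) = y ^ 2 \<longleftrightarrow>
   Affine a y \<in> ec_doubles 0 B"
proof
  assume *: "(\<exists>\<beta>\<in>rat_adjoin \<omega>. \<beta> ^ 2 = of_rat a - of_rat b * \<omega>) \<and>
     field_norm (rat_adjoin \<omega>) (of_rat a - of_rat b * \<omega>) = y ^ 2"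
  then obtain r s t where sq: "elt r s t ^ 2 = of_rat a - of_rat b * \<omega>"
    by (auto elim: mem_rat_adjoinE)
  obtain u v where uv: "root_point (elt r s t) = Affine u v"
    by (simp add: root_point_elt)
  have P: "Affine u v \<in> ec_affine_points 0 B"
    using root_point_mem[OF sq] uv by simp
  then have P': "Affine u (- v) \<in> ec_affine_points 0 B"
    by (simp add: affine_mem_iff)
  have "point_root (Affine u v) = elt r s t"
    using point_root_root_point[OF sq] uv by simp
  \<comment> \<open>Two expressions for the same square; their rational parts identify
    \<open>a\<close> with the first coordinate of the doubled point.\<close>
  then have "elt a (- b) 0 = elt ((u ^ 4 + 8 * of_int m * b ^ 3 * u) / (4 * v ^ 2)) (- b) 0"
    using sq point_root_square[OF P] by (simp add: rat_minus_rat_omega_eq_elt)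
  then have a: "(u ^ 4 + 8 * of_int m * b ^ 3 * u) / (4 * v ^ 2) = a"
    by (simp add: elt_eq_iff)
  obtain y' where y': "ec_add 0 (Affine u v) (Affine u v) = Affine a y'"
    "ec_add 0 (Affine u (- v)) (Affine u (- v)) = Affine a (- y')"
    "Affine a y' \<in> ec_affine_points 0 B"
    using ec_double[OF P] unfolding a .
  \<comment> \<open>The norm condition places \<open>(a, y)\<close> on the curve, over the same
    first coordinate as the double \<open>(a, y')\<close>.\<close>
  have "y ^ 2 = y' ^ 2"
    using * y'(3) by (simp add: field_norm_rat_minus_rat_omega affine_mem_iff)
  then have "y = y' \<or> y = - y'"
    by (simp add: power2_eq_iff)
  then show "Affine a y \<in> ec_doubles 0 B"
    using y'(1,2)[symmetric] P P' unfolding ec_doubles_def ec_points_def by blast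
next
  assume "Affine a y \<in> ec_doubles 0 B"
  then obtain Q where Q: "Q \<in> ec_points 0 B" "Affine a y = ec_add 0 Q Q"
    unfolding ec_doubles_def by auto
  \<comment> \<open>\<open>Infinity\<close> is excluded because its double is not affine.\<close>
  then obtain u v where uv: "Q = Affine u v"
    by (cases Q) auto
  then have P: "Affine u v \<in> ec_affine_points 0 B"
    using Q(1) by (simp add: ec_points_def)
  have a: "a = (u ^ 4 + 8 * of_int m * b ^ 3 * u) / (4 * v ^ 2)"
    and "Affine a y \<in> ec_affine_points 0 B"
    using ec_double[OF P] Q(2) unfolding uv by (metis ec_point.inject)+
  moreover have "point_root (Affine u v) \<in> rat_adjoin \<omega>"
    by simp
  ultimately show "(\<exists>\<beta>\<in>rat_adjoin \<omega>. \<beta> ^ 2 = of_rat a - of_rat b * \<omega>) \<and>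
     field_norm (rat_adjoin \<omega>) (of_rat a - of_rat b * \<omega>) = y ^ 2"
    using point_root_square[OF P] unfolding a field_norm_rat_minus_rat_omega affine_mem_iff by metis
qed

text \<open>The twisting factor is \<open>b\<close>, since \<open>B = b ^ 3 * (- m)\<close>;
  nonsingularity comes from \<open>m\<close> and \<open>b\<close> being nonzero.\<close>

lemma elliptic_and_twist:
  "elliptic_curve 0 (- of_int m :: rat) \<and> elliptic_curve 0 B \<and> quadratic_twist 0 (- of_int m) 0 B"
  using m_nonzero b_nonzero
  by (auto simp: elliptic_curve_def quadratic_twist_def B_def intro!: exI[of _ b])

end

theorem theorem5:
  fixes m :: int and \<omega> :: "'a::field_char_0" and K :: "'a set" and b B :: rat
    and S :: "'a set"
  assumes m_not_cube: "\<nexists>k::int. m = k ^ 3"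
    and omega: "\<omega> ^ 3 = of_int m"
    and K_def: "K = rat_adjoin \<omega>"
    and b_nonzero: "b \<noteq> 0"
    and B_def: "B = - of_int m * b ^ 3"
    and S_def: "S = {\<alpha> \<in> K. \<alpha> \<noteq> 0 \<and> (\<exists>a::rat. \<alpha> ^ 2 = of_rat a - of_rat b * \<omega>)}"
  shows "(elliptic_curve 0 (- of_int m :: rat) \<and> elliptic_curve 0 B \<and>
      quadratic_twist 0 (- of_int m) 0 B) \<and>
    (\<exists>\<phi> :: 'a \<Rightarrow> rat ec_point.
      bij_betw \<phi> S (ec_affine_points 0 B) \<and>
      (\<forall>(r::rat) (s::rat) (t::rat) (a::rat) \<alpha>.
         \<alpha> = of_rat r + of_rat s * \<omega> + of_rat t * \<omega> ^ 2 \<longrightarrow>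
         \<alpha> ^ 2 = of_rat a - of_rat b * \<omega> \<longrightarrow>
         \<alpha> \<in> S \<and> t \<noteq> 0 \<and> \<phi> \<alpha> = Affine (b * s / t) (b ^ 2 / t)) \<and>
      (\<forall>(x::rat) (y::rat) \<alpha>.
         Affine x y \<in> ec_affine_points 0 B \<longrightarrow>
         \<alpha> = of_rat (- (x ^ 2) / (2 * y)) + of_rat (b * x / y) * \<omega> + of_rat (b ^ 2 / y) * \<omega> ^ 2 \<longrightarrow>
         y \<noteq> 0 \<and> \<alpha> \<in> S \<and> \<phi> \<alpha> = Affine x y \<and>
         \<alpha> ^ 2 = of_rat ((x ^ 4 + 8 * of_int m * b ^ 3 * x) / (4 * y ^ 2)) - of_rat b * \<omega>)) \<and>
    (\<forall>(a::rat) (y::rat).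
      (\<exists>\<beta>\<in>K. \<beta> ^ 2 = of_rat a - of_rat b * \<omega>) \<and>
        field_norm K (of_rat a - of_rat b * \<omega>) = y ^ 2 \<longleftrightarrow>
      Affine a y \<in> ec_doubles 0 B)"
proof -
  interpret twisted_cubic m \<omega> b B
    using m_not_cube omega b_nonzero B_def by unfold_locales
  have S: "S = roots"
    by (simp add: S_def K_def roots_def)
  show ?thesis
  proof (intro conjI exI[of _ root_point] allI impI)
    show "bij_betw root_point S (ec_affine_points 0 B)"
      unfolding S by (rule bij_betw_root_point)
  next
    fix r s t a :: rat and \<alpha> :: 'a
    assume "\<alpha> = of_rat r + of_rat s * \<omega> + of_rat t * \<omega> ^ 2" and sq: "\<alpha> ^ 2 = of_rat a - of_rat b * \<omega>"
    then have \<alpha>: "\<alpha> = elt r s t"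
      by (simp add: elt_def)
    show "\<alpha> \<in> S" "t \<noteq> 0" "root_point \<alpha> = Affine (b * s / t) (b ^ 2 / t)"
      using sq mem_rootsI root_t_nonzero root_point_elt unfolding S \<alpha> by blast+
  next
    fix x y :: rat and \<alpha> :: 'a
    assume P: "Affine x y \<in> ec_affine_points 0 B"
      and "\<alpha> = of_rat (- (x ^ 2) / (2 * y)) + of_rat (b * x / y) * \<omega> + of_rat (b ^ 2 / y) * \<omega> ^ 2"
    then have \<alpha>: "\<alpha> = point_root (Affine x y)"
      by (simp add: elt_def)
    show "y \<noteq> 0" "\<alpha> \<in> S" "root_point \<alpha> = Affine x y"
      "\<alpha> ^ 2 = of_rat ((x ^ 4 + 8 * of_int m * b ^ 3 * x) / (4 * y ^ 2)) - of_rat b * \<omega>"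
      using affine_y_nonzero[OF P] point_root_mem[OF P] root_point_point_root[OF P] point_root_square[OF P]
      unfolding S \<alpha> by blast+
  qed (use elliptic_and_twist square_iff_mem_ec_doubles K_def in auto)
qed

end
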